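(* Every homogeneous proper ultra-metric space $X$ is coarsely equivalent to the anti-Cantor set $2^{<\omega}$.
   Context: A metric space $(X,d)$ is: homogeneous if for any $x,y\in X$ there is an isometric bijection $f:X\to X$ with $f(x)=y$; proper if $X$ is unbounded but for every $x_0\in X$ and $r\in[0,\infty)$ the closed ball $B_r(x_0)=\{x\in X: d(x,x_0)\le r\}$ is compact; an ultra-metric space if $d(x,y)\le\max\{d(x,z),d(z,y)\}$ for all $x,y,z\in X$. The anti-Cantor set is $2^{<\omega}=\{(x_i)_{i\in\omega}\in\{0,1\}^{\omega}:\exists m\ \forall i\ge m\ x_i=0\}$ with the ultrametric $D(\vec x,\vec y)=\max_{n\in\omega}2^n|x_n-y_n|$. A map $f:X\to Y$ between metric spaces is bornologous if for every real $\varepsilon$ there is a real $\delta$ such that $\mathrm{dist}(x,x')\le\varepsilon$ implies $\mathrm{dist}(f(x),f(x'))\le\delta$ for all $x,x'\in X$. Metric spaces $X,Y$ are coarsely equivalent if there are bornologous maps $f:X\to Y$ and $g:Y\to X$ such that $\mathrm{dist}(g\circ f,\mathrm{id}_X)<\infty$ and $\mathrm{dist}(f\circ g,\mathrm{id}_Y)<\infty$, where $\mathrm{dist}(p,q)=\sup_z \mathrm{dist}(p(z),q(z))$ for maps $p,q$. *)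

theory Defs
  imports "HOL-Analysis.Analysis"
begin

locale Ultrametric_space = Metric_space +
  assumes ultrametric: "\<lbrakk>x \<in> M; y \<in> M; z \<in> M\<rbrakk> \<Longrightarrow> d x y \<le> max (d x z) (d z y)"

definition (in Metric_space) homogeneous :: bool where
  "homogeneous \<longleftrightarrow> (\<forall>x\<in>M. \<forall>y\<in>M. \<exists>f. bij_betw f M M \<and>
     (\<forall>u\<in>M. \<forall>v\<in>M. d (f u) (f v) = d u v) \<and> f x = y)"

(* Properness includes unboundedness. *)
definition (in Metric_space) proper :: bool where
  "proper \<longleftrightarrow> \<not> mbounded M \<and> (\<forall>x\<in>M. \<forall>r\<ge>0. compactin mtopology (mcball x r))"

definition bornologous ::
    "'a set \<Rightarrow> ('a \<Rightarrow> 'a \<Rightarrow> real) \<Rightarrow> ('b \<Rightarrow> 'b \<Rightarrow> real) \<Rightarrow> ('a \<Rightarrow> 'b) \<Rightarrow> bool" where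
  "bornologous X dX dY f \<longleftrightarrow>
     (\<forall>\<epsilon>::real. \<exists>\<delta>::real. \<forall>x\<in>X. \<forall>x'\<in>X. dX x x' \<le> \<epsilon> \<longrightarrow> dY (f x) (f x') \<le> \<delta>)"

definition map_dist ::
    "'a set \<Rightarrow> ('b \<Rightarrow> 'b \<Rightarrow> real) \<Rightarrow> ('a \<Rightarrow> 'b) \<Rightarrow> ('a \<Rightarrow> 'b) \<Rightarrow> ennreal" where
  "map_dist Z dY p q = (SUP z\<in>Z. ennreal (dY (p z) (q z)))"

definition coarsely_equivalent ::
    "'a set \<Rightarrow> ('a \<Rightarrow> 'a \<Rightarrow> real) \<Rightarrow> 'b set \<Rightarrow> ('b \<Rightarrow> 'b \<Rightarrow> real) \<Rightarrow> bool" where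
  "coarsely_equivalent X dX Y dY \<longleftrightarrow>
     (\<exists>f g. f \<in> X \<rightarrow> Y \<and> g \<in> Y \<rightarrow> X \<and>
        bornologous X dX dY f \<and> bornologous Y dY dX g \<and>
        map_dist X dX (g \<circ> f) id < \<infinity> \<and> map_dist Y dY (f \<circ> g) id < \<infinity>)"

definition anti_Cantor :: "(nat \<Rightarrow> nat) set" where
  "anti_Cantor = {x. (\<forall>i. x i \<in> {0, 1}) \<and> (\<exists>m. \<forall>i\<ge>m. x i = 0)}"

(* On anti_Cantor the range is finite, so Max is a genuine maximum; the value 0 off the
   carrier only serves the locale Metric_space, which wants d nonnegative on the whole type. *)
definition anti_Cantor_dist :: "(nat \<Rightarrow> nat) \<Rightarrow> (nat \<Rightarrow> nat) \<Rightarrow> real" where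
  "anti_Cantor_dist x y =
     (if x \<in> anti_Cantor \<and> y \<in> anti_Cantor
      then Max (range (\<lambda>n. 2 ^ n * \<bar>real (x n) - real (y n)\<bar>)) else 0)"

lemma finite_range_anti_Cantor_dist:
  assumes "x \<in> anti_Cantor" "y \<in> anti_Cantor"
  shows "finite (range (\<lambda>n. 2 ^ n * \<bar>real (x n) - real (y n)\<bar>))"
proof -
  obtain m m' where m: "\<And>i. i \<ge> m \<Longrightarrow> x i = 0" "\<And>i. i \<ge> m' \<Longrightarrow> y i = 0"
    using assms unfolding anti_Cantor_def by blast
  have "range (\<lambda>n. 2 ^ n * \<bar>real (x n) - real (y n)\<bar>) \<subseteq>
      insert 0 ((\<lambda>n. 2 ^ n * \<bar>real (x n) - real (y n)\<bar>) ` {..< max m m'})"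
  proof
    fix t assume "t \<in> range (\<lambda>n. 2 ^ n * \<bar>real (x n) - real (y n)\<bar>)"
    then obtain n where n: "t = 2 ^ n * \<bar>real (x n) - real (y n)\<bar>" by blast
    show "t \<in> insert 0 ((\<lambda>n. 2 ^ n * \<bar>real (x n) - real (y n)\<bar>) ` {..< max m m'})"
      using n m by (cases "n < max m m'") auto
  qed
  then show ?thesis by (rule finite_subset) simp
qed

lemma anti_Cantor_dist_le_iff:
  assumes "x \<in> anti_Cantor" "y \<in> anti_Cantor"
  shows "anti_Cantor_dist x y \<le> c \<longleftrightarrow> (\<forall>n. 2 ^ n * \<bar>real (x n) - real (y n)\<bar> \<le> c)"
  using Max_le_iff[OF finite_range_anti_Cantor_dist[OF assms]] assms
  by (simp add: anti_Cantor_dist_def)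

lemma Ultrametric_space_anti_Cantor: "Ultrametric_space anti_Cantor anti_Cantor_dist"
proof -
  let ?D = "anti_Cantor_dist"
  have ub: "2 ^ n * \<bar>real (x n) - real (y n)\<bar> \<le> ?D x y"
    if "x \<in> anti_Cantor" "y \<in> anti_Cantor" for x y n
    using anti_Cantor_dist_le_iff[OF that, of "?D x y"] by blast
  have nn: "0 \<le> ?D x y" if "x \<in> anti_Cantor" "y \<in> anti_Cantor" for x y
    using ub[OF that, of 0] by simp
  have um: "?D x y \<le> max (?D x z) (?D z y)"
    if x: "x \<in> anti_Cantor" and y: "y \<in> anti_Cantor" and z: "z \<in> anti_Cantor" for x y z
    unfolding anti_Cantor_dist_le_iff[OF x y]
  proof
    fix n
    have "x n \<in> {0, 1}" "y n \<in> {0, 1}" "z n \<in> {0, 1}"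
      using x y z by (auto simp: anti_Cantor_def)
    then have "\<bar>real (x n) - real (y n)\<bar> = 0 \<or>
        \<bar>real (x n) - real (y n)\<bar> = \<bar>real (x n) - real (z n)\<bar> \<or>
        \<bar>real (x n) - real (y n)\<bar> = \<bar>real (z n) - real (y n)\<bar>"
      by auto
    then show "2 ^ n * \<bar>real (x n) - real (y n)\<bar> \<le> max (?D x z) (?D z y)"
      using ub[OF x z, of n] ub[OF z y, of n] nn[OF x z] by (elim disjE) (simp_all add: le_max_iff_disj)
  qed
  have zero: "?D x y = 0 \<longleftrightarrow> x = y" if "x \<in> anti_Cantor" "y \<in> anti_Cantor" for x y
  proof
    assume "?D x y = 0"
    then have "2 ^ n * \<bar>real (x n) - real (y n)\<bar> \<le> 0" for n
      using ub[OF that, of n] by simp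
    then have "x n = y n" for n
      by (metis abs_le_zero_iff eq_iff_diff_eq_0 mult_le_cancel_left_pos mult_zero_right
          of_nat_eq_iff zero_less_numeral zero_less_power)
    then show "x = y" by blast
  next
    assume "x = y"
    then show "?D x y = 0"
      by (simp add: anti_Cantor_dist_def)
  qed
  show ?thesis
  proof
    show "0 \<le> ?D x y" for x y
      using nn[of x y] by (cases "x \<in> anti_Cantor \<and> y \<in> anti_Cantor") (auto simp: anti_Cantor_dist_def)
    show "?D x y = ?D y x" for x y
      by (simp add: anti_Cantor_dist_def abs_minus_commute)
    show "?D x y = 0 \<longleftrightarrow> x = y" if "x \<in> anti_Cantor" "y \<in> anti_Cantor" for x y
      using zero[OF that] .
    show "?D x z \<le> ?D x y + ?D y z"
      if "x \<in> anti_Cantor" "y \<in> anti_Cantor" "z \<in> anti_Cantor" for x y z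
      using um[OF that(1,3,2)] nn[OF that(1,2)] nn[OF that(2,3)] by linarith
    show "?D x y \<le> max (?D x z) (?D z y)"
      if "x \<in> anti_Cantor" "y \<in> anti_Cantor" "z \<in> anti_Cantor" for x y z
      using um[OF that] .
  qed
qed

end

theory Submission imports Defs begin

text \<open>
  The proof shows more: any two homogeneous proper ultrametric spaces \<open>X\<close> and \<open>Y\<close> are coarsely
  equivalent (\<open>coarsely_equivalent_homogeneous_proper\<close>). The anti-Cantor set is such a space, since
  flipping coordinates is transitive and its balls are finite.

  In an ultrametric space the closed balls of one radius partition the space, and by compactness and
  homogeneity every ball of radius \<open>R\<close> splits into the same finite number of balls of radius \<open>r\<close>; by
  unboundedness this number is as large as one likes for large \<open>R\<close>. So, up to coarse equivalence,
  \<open>X\<close> is described by radii \<open>r 0 < r 1 < \<dots>\<close> and the numbers \<open>k n\<close> of \<open>r n\<close>-balls in an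
  \<open>r (n + 1)\<close>-ball, and \<open>Y\<close> by radii \<open>s n\<close> and numbers \<open>q n\<close>. The two trees of balls need not be
  isomorphic: the \<open>k n\<close> may all be powers of 3 while the \<open>q n\<close> are powers of 2.
  What is needed is only a map \<open>g\<close> from \<open>Y\<close> to \<open>X\<close> such that points in a common \<open>s n\<close>-ball go to a
  common \<open>r n\<close>-ball, points that go to a common \<open>r n\<close>-ball lie in a common \<open>s (n + 1)\<close>-ball, and
  every point of \<open>X\<close> is within \<open>r 0\<close> of the image.

  In other words, the preimage of an \<open>r n\<close>-ball has to be a block: a union of \<open>s n\<close>-balls inside one
  \<open>s (n + 1)\<close>-ball. Divisibility is circumvented by letting the number of balls in a block vary in
  an interval \<open>[a n, b n]\<close>. The preimage of an \<open>r (n + 1)\<close>-ball, made of \<open>N\<close> balls of radius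
  \<open>s (n + 1)\<close> with \<open>a (n + 1) \<le> N \<le> b (n + 1)\<close>, has to be cut into \<open>k n\<close> blocks. Assign to each of the
  \<open>N\<close> balls some number \<open>t\<close> of the \<open>k n\<close> balls in \<open>X\<close>, and cut its \<open>q n\<close> subballs into \<open>t\<close> parts.
  If \<open>t\<close> may range over \<open>[u n, v n]\<close>, this is possible as soon as
  \<open>b (n + 1) * u n \<le> k n \<le> a (n + 1) * v n\<close> and, roughly, \<open>v n * a n \<le> q n \<le> u n * b n\<close>. Such data
  exist by recursion with the sole invariant \<open>0 < a n < b n\<close>: a large \<open>q n\<close> leaves room for
  \<open>u n < v n\<close> (\<open>multiplicity_range\<close>), and then a large \<open>k n\<close> leaves room for
  \<open>a (n + 1) < b (n + 1)\<close> (\<open>size_range\<close>).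

  Cutting goes from large balls to small ones, so it defines \<open>g\<close> on blocks, not yet on all of \<open>Y\<close>.
  To exhaust \<open>Y\<close>, the cutting is done so that a prescribed block of minimal size is one of the parts
  (\<open>block_map\<close>). Hence a map on such a block extends to the next one (\<open>interleaving_extend\<close>),
  and the union over an increasing sequence of blocks is the desired \<open>g\<close> (\<open>ex_interleaving\<close>).
\<close>

section \<open>Maps between finite sets with fibres of controlled size\<close>

lemma split_into_fibres:
  fixes S :: "'s set" and T :: "'t set"
  assumes "finite T" "finite S" "card T * a \<le> card S" "card S \<le> card T * b"
  shows "\<exists>p\<in>S \<rightarrow> T. \<forall>t\<in>T. a \<le> card {s\<in>S. p s = t} \<and> card {s\<in>S. p s = t} \<le> b"
  using assms
proof (induction T arbitrary: S rule: finite_induct)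
  case empty
  then show ?case by auto
next
  case (insert t T)
  have cT: "card (insert t T) = Suc (card T)"
    using insert.hyps by simp
  define m where "m = min b (card S - card T * a)"
  have le: "card T * a \<le> card S" "a + card T * a \<le> card S" "card S \<le> b + card T * b"
    using insert.prems unfolding cT by simp_all
  have ab: "a \<le> b"
  proof (rule ccontr)
    assume "\<not> a \<le> b"
    moreover from this have "card T * b \<le> card T * a" by simp
    ultimately show False using le by linarith
  qed
  have ab': "card T * a \<le> card T * b"
    using ab by simp
  have m: "a \<le> m" "m \<le> b" "m \<le> card S" "card T * a \<le> card S - m" "card S - m \<le> card T * b"
    using le ab ab' unfolding m_def by linarith+
  obtain A where A: "A \<subseteq> S" "card A = m" "finite A"
    using obtain_subset_with_card_n[OF m(3)] by metis
  have cA: "card (S - A) = card S - m"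
    using A by (simp add: card_Diff_subset)
  obtain p where p: "p \<in> (S - A) \<rightarrow> T"
      "\<And>t. t \<in> T \<Longrightarrow> a \<le> card {s\<in>S - A. p s = t} \<and> card {s\<in>S - A. p s = t} \<le> b"
    using insert.IH[of "S - A"] insert.prems(1) m(4,5) unfolding cA by auto
  define p' where "p' = (\<lambda>s. if s \<in> A then t else p s)"
  have "{s\<in>S. p' s = t} = A"
    using A(1) p(1) insert.hyps unfolding p'_def by (auto split: if_splits)
  moreover have "{s\<in>S. p' s = t'} = {s\<in>S - A. p s = t'}" if "t' \<in> T" for t'
    using that insert.hyps unfolding p'_def by (auto split: if_splits)
  moreover have "p' \<in> S \<rightarrow> insert t T"
    using p(1) unfolding p'_def Pi_iff by auto
  ultimately show ?case
    using A(2) m(1,2) p(2) by (intro bexI[of _ p']) auto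
qed

text \<open>Composition with a transposition of \<open>T\<close> only permutes the fibres.\<close>

lemma split_into_fibres_with_value:
  fixes S :: "'s set" and T :: "'t set"
  assumes "finite T" "finite S" "card T * a \<le> card S" "card S \<le> card T * b" "s0 \<in> S" "t0 \<in> T"
  shows "\<exists>p\<in>S \<rightarrow> T. p s0 = t0 \<and>
           (\<forall>t\<in>T. a \<le> card {s\<in>S. p s = t} \<and> card {s\<in>S. p s = t} \<le> b)"
proof -
  obtain p where p: "p \<in> S \<rightarrow> T"
      "\<And>t. t \<in> T \<Longrightarrow> a \<le> card {s\<in>S. p s = t} \<and> card {s\<in>S. p s = t} \<le> b"
    using split_into_fibres[OF assms(1-4)] by blast
  define \<tau> where "\<tau> = Transposition.transpose (p s0) t0"
  have \<tau>: "\<tau> (\<tau> t) = t" for t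
    unfolding \<tau>_def by simp
  have \<tau>T: "\<tau> t \<in> T" if "t \<in> T" for t
    using that p(1) assms(5,6) unfolding \<tau>_def Transposition.transpose_def by auto
  have "{s\<in>S. (\<tau> \<circ> p) s = t} = {s\<in>S. p s = \<tau> t}" for t
    using \<tau> by (auto simp: o_def)
  moreover have "(\<tau> \<circ> p) s0 = t0"
    unfolding \<tau>_def by simp
  moreover have "\<tau> \<circ> p \<in> S \<rightarrow> T"
    using p(1) \<tau>T by (auto simp: Pi_iff)
  ultimately show ?thesis
    using p(2) \<tau>T by (intro bexI[of _ "\<tau> \<circ> p"]) auto
qed

text \<open>The prescribed fibre has the minimal size \<open>a\<close>, so removing it preserves the lower bound for the
  remaining elements. The upper bound would be lost, hence the stronger assumption
  with \<open>card T - 1\<close>.\<close>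

lemma split_into_fibres_with_fibre:
  fixes S :: "'s set" and T :: "'t set"
  assumes "finite T" "finite S" "card T * a \<le> card S" "card S \<le> (card T - 1) * b"
    and "A \<subseteq> S" "card A = a" "a \<le> b" "t0 \<in> T"
  shows "\<exists>p\<in>S \<rightarrow> T. {s\<in>S. p s = t0} = A \<and>
           (\<forall>t\<in>T. a \<le> card {s\<in>S. p s = t} \<and> card {s\<in>S. p s = t} \<le> b)"
proof -
  have cA: "card (S - A) = card S - a"
    using assms by (metis card_Diff_subset finite_subset)
  have cT: "card (T - {t0}) = card T - 1"
    using assms by simp
  have "(card T - 1) * a \<le> card S - a"
    using assms(3) by (simp add: diff_mult_distrib)
  then obtain p where p: "p \<in> (S - A) \<rightarrow> (T - {t0})"
      "\<And>t. t \<in> T - {t0} \<Longrightarrow> a \<le> card {s\<in>S - A. p s = t} \<and> card {s\<in>S - A. p s = t} \<le> b"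
    using split_into_fibres[of "T - {t0}" "S - A" a b] assms(1,2,4) unfolding cA cT by fastforce
  define p' where "p' = (\<lambda>s. if s \<in> A then t0 else p s)"
  have A: "{s\<in>S. p' s = t0} = A"
    using assms(5) p(1) unfolding p'_def by (auto split: if_splits)
  moreover have "{s\<in>S. p' s = t'} = {s\<in>S - A. p s = t'}" if "t' \<in> T - {t0}" for t'
    using that unfolding p'_def by (auto split: if_splits)
  then have "a \<le> card {s\<in>S. p' s = t} \<and> card {s\<in>S. p' s = t} \<le> b" if "t \<in> T" for t
    using that A p(2)[of t] assms(6,7) by (cases "t = t0") auto
  moreover have "p' \<in> S \<rightarrow> T"
    using p(1) assms(8) unfolding p'_def Pi_iff by auto
  ultimately show ?thesis
    by (intro bexI[of _ p']) auto
qed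

section \<open>Towers of ball partitions\<close>

text \<open>The combinatorial content of a homogeneous proper ultrametric space: \<open>B n x\<close> is the block around
  \<open>x\<close> of the \<open>n\<close>-th of a coarsening sequence of partitions, with constant branching numbers \<open>k n\<close>.
  Positivity of \<open>k n\<close> is what makes \<open>card_subballs\<close> assert finiteness.\<close>

locale ball_tower =
  fixes M :: "'a set" and B :: "nat \<Rightarrow> 'a \<Rightarrow> 'a set" and k :: "nat \<Rightarrow> nat"
  assumes centre_mem: "x \<in> M \<Longrightarrow> x \<in> B n x"
    and ball_subset: "x \<in> M \<Longrightarrow> B n x \<subseteq> M"
    and ball_eq: "x \<in> M \<Longrightarrow> y \<in> B n x \<Longrightarrow> B n y = B n x"
    and ball_Suc: "x \<in> M \<Longrightarrow> B n x \<subseteq> B (Suc n) x"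
    and exhausts: "x \<in> M \<Longrightarrow> y \<in> M \<Longrightarrow> \<exists>n. y \<in> B n x"
    and card_subballs: "x \<in> M \<Longrightarrow> card (B n ` B (Suc n) x) = k n"
    and k_pos: "0 < k n"
begin

lemma ball_mono: "x \<in> M \<Longrightarrow> m \<le> n \<Longrightarrow> B m x \<subseteq> B n x"
  by (rule lift_Suc_mono_le[of "\<lambda>n. B n x"]) (use ball_Suc in auto)

lemma ball_eq_mono: "x \<in> M \<Longrightarrow> y \<in> B m x \<Longrightarrow> m \<le> n \<Longrightarrow> B n y = B n x"
  using ball_mono ball_eq by blast

lemma ball_sym: "x \<in> M \<Longrightarrow> y \<in> B n x \<Longrightarrow> x \<in> B n y"
  using ball_eq centre_mem by blast

lemma finite_subballs: "x \<in> M \<Longrightarrow> finite (B n ` B (Suc n) x)"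
  using card_subballs[of x n] k_pos[of n] card_gt_0_iff by metis

end

section \<open>Interleaving two towers\<close>

text \<open>The interval \<open>[a n, b n]\<close> bounds the number of level-\<open>n\<close> balls of \<open>L\<close> in the preimage of a level-\<open>n\<close>
  ball of \<open>M\<close>, and \<open>[u n, v n]\<close> the number of level-\<open>n\<close> balls of \<open>M\<close> whose preimages share
  a level-\<open>(n + 1)\<close> ball of \<open>L\<close>. The summand \<open>- 1\<close> in \<open>q_upper\<close> is the price for prescribing one of the
  preimages.\<close>

locale interleaved_towers = X: ball_tower M E k + Y: ball_tower L F q
  for M :: "'a set" and E k and L :: "'b set" and F q +
  fixes a b u v :: "nat \<Rightarrow> nat"
  assumes a_pos: "0 < a n" and a_le_b: "a n \<le> b n"
    and q_lower: "v n * a n \<le> q n" and q_upper: "q n \<le> (u n - 1) * b n"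
    and k_lower: "b (Suc n) * u n \<le> k n" and k_upper: "k n \<le> a (Suc n) * v n"
begin

definition block :: "nat \<Rightarrow> 'b set \<Rightarrow> bool" where
  "block n V \<longleftrightarrow> V \<subseteq> L \<and> (\<forall>y\<in>V. F n y \<subseteq> V \<and> V \<subseteq> F (Suc n) y) \<and>
     a n \<le> card (F n ` V) \<and> card (F n ` V) \<le> b n"

text \<open>With \<open>V\<close> and \<open>U\<close> the full spaces, \<open>g\<close> is a coarse equivalence whose control functions are the
  shifts of levels \<open>m \<mapsto> m\<close> in one direction and \<open>m \<mapsto> m + 1\<close> in the other. They are the same for
  all \<open>V\<close> and \<open>U\<close>, so interleavings of parts can be glued.\<close>

definition interleaving :: "'b set \<Rightarrow> 'a set \<Rightarrow> ('b \<Rightarrow> 'a) \<Rightarrow> bool" where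
  "interleaving V U g \<longleftrightarrow> g \<in> V \<rightarrow> U \<and>
     (\<forall>m. \<forall>y\<in>V. \<forall>y'\<in>V. y' \<in> F m y \<longrightarrow> g y' \<in> E m (g y)) \<and>
     (\<forall>m. \<forall>y\<in>V. \<forall>y'\<in>V. g y' \<in> E m (g y) \<longrightarrow> y' \<in> F (Suc m) y) \<and>
     (\<forall>x\<in>U. \<exists>y\<in>V. g y \<in> E 0 x)"

lemma block_nonempty: "block n V \<Longrightarrow> V \<noteq> {}"
  using a_pos[of n] unfolding block_def by auto

lemma block_finite: "block n V \<Longrightarrow> finite (F n ` V)"
  using a_pos[of n] unfolding block_def by (metis card.infinite leD)

lemma a_le_q: "a n \<le> q n"
proof -
  have "v n \<noteq> 0"
    using X.k_pos[of n] k_upper[of n] by (metis mult_0_right not_le)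
  then show ?thesis using q_lower[of n] by (metis le_trans mult.commute mult_le_mono2 mult_1_right Suc_leI neq0_conv One_nat_def)
qed

text \<open>Blocks of minimal size around a point; they exhaust \<open>L\<close>, and they are the parts that \<open>block_map\<close>
  can prescribe.\<close>

lemma block_of_subballs:
  assumes "y0 \<in> L"
  shows "\<exists>W. block n W \<and> F n y0 \<subseteq> W \<and> W \<subseteq> F (Suc n) y0 \<and> card (F n ` W) = a n"
proof -
  have fin: "finite (F n ` F (Suc n) y0)" and cq: "card (F n ` F (Suc n) y0) = q n"
    using Y.finite_subballs Y.card_subballs assms by auto
  have "F n y0 \<in> F n ` F (Suc n) y0"
    using Y.centre_mem assms by blast
  then obtain \<A> where \<A>: "{F n y0} \<subseteq> \<A>" "\<A> \<subseteq> F n ` F (Suc n) y0" "card \<A> = a n"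
    using exists_subset_between[of "{F n y0}" "a n" "F n ` F (Suc n) y0"] a_pos[of n] a_le_q[of n] fin cq
    by auto
  define W where "W = \<Union>\<A>"
  have sub: "W \<subseteq> F (Suc n) y0"
  proof
    fix y assume "y \<in> W"
    then obtain z where z: "z \<in> F (Suc n) y0" "y \<in> F n z"
      using \<A>(2) unfolding W_def by blast
    then have "z \<in> L" using Y.ball_subset assms by blast
    then show "y \<in> F (Suc n) y0"
      using z(2) Y.ball_Suc[of z n] Y.ball_eq[OF assms z(1)] by auto
  qed
  have L: "W \<subseteq> L" using sub Y.ball_subset assms by blast
  have inA: "F n y \<in> \<A>" if y: "y \<in> W" for y
  proof -
    obtain z where z: "z \<in> F (Suc n) y0" "y \<in> F n z" "F n z \<in> \<A>"
      using \<A>(2) y unfolding W_def by blast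
    then have "z \<in> L" using Y.ball_subset assms by blast
    then show ?thesis using z Y.ball_eq by metis
  qed
  have im: "F n ` W = \<A>"
  proof
    show "F n ` W \<subseteq> \<A>" using inA by blast
    show "\<A> \<subseteq> F n ` W"
    proof
      fix C assume C: "C \<in> \<A>"
      then obtain z where z: "C = F n z" "z \<in> F (Suc n) y0" using \<A>(2) by blast
      then have "z \<in> W" using C Y.centre_mem Y.ball_subset assms unfolding W_def by blast
      then show "C \<in> F n ` W" using z by blast
    qed
  qed
  have "F n y \<subseteq> W" if "y \<in> W" for y
    using inA[OF that] unfolding W_def by blast
  moreover have "W \<subseteq> F (Suc n) y" if "y \<in> W" for y
    using that sub Y.ball_eq assms by blast
  ultimately have "block n W"
    unfolding block_def using L im \<A>(3) a_le_b by auto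
  moreover have "F n y0 \<subseteq> W" using \<A>(1) unfolding W_def by blast
  ultimately show ?thesis using sub im \<A>(3) by blast
qed

text \<open>The cutting step. Here \<open>h\<close> sends a point of the block \<open>V\<close> to the level-\<open>n\<close> ball of \<open>M\<close> that it is
  meant for. It comes from two splittings: \<open>p\<close> distributes the level-\<open>n\<close> balls of \<open>E (Suc n) x\<close>
  over the level-\<open>(n + 1)\<close> balls \<open>C\<close> of \<open>V\<close>, and \<open>G C\<close> distributes the level-\<open>n\<close> balls of \<open>C\<close> over the
  balls that \<open>p\<close> assigns to \<open>C\<close>. Cutting within each \<open>C\<close> separately keeps the preimages inside a single
  level-\<open>(n + 1)\<close> ball.\<close>

lemma block_map:
  assumes x: "x \<in> M" and V: "block (Suc n) V" and W: "block n W" "W \<subseteq> V" "card (F n ` W) = a n"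
  obtains h where "h \<in> V \<rightarrow> E n ` E (Suc n) x"
    "\<And>y y'. y \<in> V \<Longrightarrow> y' \<in> F n y \<Longrightarrow> h y' = h y"
    "\<And>c. c \<in> E n ` E (Suc n) x \<Longrightarrow> block n {y\<in>V. h y = c}"
    "{y\<in>V. h y = E n x} = W"
proof -
  let ?T = "E n ` E (Suc n) x" and ?P = "F (Suc n) ` V"
  have VL: "V \<subseteq> L" and Vsat: "\<And>y. y \<in> V \<Longrightarrow> F (Suc n) y \<subseteq> V"
    using V unfolding block_def by auto
  obtain w where w: "w \<in> W" using block_nonempty[OF W(1)] by blast
  then have wV: "w \<in> V" and wL: "w \<in> L" using W(2) VL by auto
  let ?C0 = "F (Suc n) w"
  have WC0: "W \<subseteq> ?C0" using W(1) w unfolding block_def by blast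
  have finT: "finite ?T" and cT: "card ?T = k n"
    using X.finite_subballs X.card_subballs x by auto
  have finP: "finite ?P" by (rule block_finite[OF V])
  have cP: "a (Suc n) \<le> card ?P" "card ?P \<le> b (Suc n)"
    using V unfolding block_def by auto
  have "card ?P * u n \<le> k n" "k n \<le> card ?P * v n"
    using mult_le_mono1[OF cP(2), of "u n"] mult_le_mono1[OF cP(1), of "v n"] k_lower[of n] k_upper[of n]
    by linarith+
  moreover have "E n x \<in> ?T" using X.centre_mem x by blast
  moreover have "?C0 \<in> ?P" using wV by blast
  ultimately obtain p where p: "p \<in> ?T \<rightarrow> ?P" "p (E n x) = ?C0"
    and pf: "\<And>C. C \<in> ?P \<Longrightarrow> u n \<le> card {c\<in>?T. p c = C} \<and> card {c\<in>?T. p c = C} \<le> v n"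
    using split_into_fibres_with_value[OF finP finT, of "u n" "v n" "E n x" ?C0] unfolding cT by blast
  \<comment> \<open>The last clause prescribes \<open>W\<close> as the part of \<open>?C0\<close> that is meant for the ball around \<open>x\<close>.\<close>
  define fibred where "fibred = (\<lambda>C G. G \<in> F n ` C \<rightarrow> {c\<in>?T. p c = C} \<and>
      (\<forall>c\<in>{c\<in>?T. p c = C}. a n \<le> card {S\<in>F n ` C. G S = c} \<and> card {S\<in>F n ` C. G S = c} \<le> b n) \<and>
      (C = ?C0 \<longrightarrow> {S\<in>F n ` C. G S = E n x} = F n ` W))"
  have "\<exists>G. fibred C G" if C: "C \<in> ?P" for C
  proof -
    let ?TC = "{c\<in>?T. p c = C}"
    obtain y where y: "y \<in> V" "C = F (Suc n) y" using C by blast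
    then have yL: "y \<in> L" using VL by blast
    have fin: "finite (F n ` C)" and cq: "card (F n ` C) = q n"
      using Y.finite_subballs Y.card_subballs yL y(2) by auto
    have finTC: "finite ?TC" using finT by simp
    have 1: "card ?TC * a n \<le> card (F n ` C)"
      using pf[OF C] mult_le_mono1[of "card ?TC" "v n" "a n"] q_lower[of n] cq by linarith
    have 2: "card (F n ` C) \<le> (card ?TC - 1) * b n"
      using pf[OF C] mult_le_mono1[of "u n - 1" "card ?TC - 1" "b n"] q_upper[of n] cq by linarith
    have 3: "(card ?TC - 1) * b n \<le> card ?TC * b n" by simp
    show ?thesis
    proof (cases "C = ?C0")
      case True
      have mem: "E n x \<in> ?TC" using p(2) True \<open>E n x \<in> ?T\<close> by simp
      have "F n ` W \<subseteq> F n ` C" using WC0 True by blast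
      from split_into_fibres_with_fibre[OF finTC fin 1 2 this W(3) a_le_b mem]
      show ?thesis
      proof (elim bexE conjE)
        fix G
        assume "G \<in> F n ` C \<rightarrow> ?TC" "{S\<in>F n ` C. G S = E n x} = F n ` W"
          "\<forall>c\<in>?TC. a n \<le> card {S\<in>F n ` C. G S = c} \<and> card {S\<in>F n ` C. G S = c} \<le> b n"
        then have "fibred C G" unfolding fibred_def by (intro conjI impI)
        then show "\<exists>G. fibred C G" by (intro exI[of _ G])
      qed
    next
      case False
      from split_into_fibres[OF finTC fin 1 order_trans[OF 2 3]]
      show ?thesis
      proof (elim bexE)
        fix G
        assume "G \<in> F n ` C \<rightarrow> ?TC"
          "\<forall>c\<in>?TC. a n \<le> card {S\<in>F n ` C. G S = c} \<and> card {S\<in>F n ` C. G S = c} \<le> b n"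
        then have "fibred C G" unfolding fibred_def using False by (intro conjI impI) (assumption | blast)+
        then show "\<exists>G. fibred C G" by (intro exI[of _ G])
      qed
    qed
  qed
  then obtain G where fibred: "\<And>C. C \<in> ?P \<Longrightarrow> fibred C (G C)"
    by metis
  have G: "G C \<in> F n ` C \<rightarrow> {c\<in>?T. p c = C}" if "C \<in> ?P" for C
    using fibred[OF that] unfolding fibred_def by (elim conjE)
  have G_card: "a n \<le> card {S\<in>F n ` C. G C S = c} \<and> card {S\<in>F n ` C. G C S = c} \<le> b n"
    if "C \<in> ?P" "c \<in> ?T" "p c = C" for C c
    using fibred[OF that(1)] that(2,3) unfolding fibred_def by simp
  have G_base: "{S\<in>F n ` ?C0. G ?C0 S = E n x} = F n ` W"
    using fibred[OF \<open>?C0 \<in> ?P\<close>] unfolding fibred_def by simp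
  define h where "h = (\<lambda>y. G (F (Suc n) y) (F n y))"
  have hT: "h y \<in> ?T" and ph: "p (h y) = F (Suc n) y" if "y \<in> V" for y
  proof -
    have "F n y \<in> F n ` F (Suc n) y" using Y.centre_mem that VL by blast
    then have "h y \<in> {c\<in>?T. p c = F (Suc n) y}"
      using G[of "F (Suc n) y"] that unfolding h_def by blast
    then show "h y \<in> ?T" "p (h y) = F (Suc n) y" by auto
  qed
  have hF: "h y' = h y" if "y \<in> V" "y' \<in> F n y" for y y'
  proof -
    have "y \<in> L" using that VL by blast
    then show ?thesis
      using Y.ball_eq[of y y' n] Y.ball_eq[of y y' "Suc n"] Y.ball_Suc[of y n] that(2)
      unfolding h_def by auto
  qed
  have fib: "{y\<in>V. h y = c} = {y\<in>p c. G (p c) (F n y) = c}"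
    and fibim: "F n ` {y\<in>V. h y = c} = {S\<in>F n ` p c. G (p c) S = c}" if c: "c \<in> ?T" for c
  proof -
    obtain z where z: "z \<in> V" "p c = F (Suc n) z" using p(1) c by blast
    then have zL: "z \<in> L" using VL by blast
    have 1: "F (Suc n) y = p c" if "y \<in> p c" for y
      using Y.ball_eq zL z(2) that by auto
    have 2: "y \<in> V" if "y \<in> p c" for y using Vsat z that by blast
    have 3: "y \<in> p c" if "y \<in> V" "h y = c" for y
      using ph[OF that(1)] that(2) Y.centre_mem[of y "Suc n"] VL that(1) by auto
    have 4: "h y = G (p c) (F n y)" if "y \<in> p c" for y
      unfolding h_def 1[OF that] ..
    show 5: "{y\<in>V. h y = c} = {y\<in>p c. G (p c) (F n y) = c}"
      using 2 3 4 by (intro Collect_cong) metis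
    show "F n ` {y\<in>V. h y = c} = {S\<in>F n ` p c. G (p c) S = c}"
      unfolding 5 by auto
  qed
  have blk: "block n {y\<in>V. h y = c}" if c: "c \<in> ?T" for c
  proof -
    have pc: "p c \<in> ?P" using p(1) c by blast
    have "F n y \<subseteq> {y\<in>V. h y = c}" if "y \<in> V" "h y = c" for y
      using hF that Vsat Y.ball_Suc[of y n] VL by blast
    moreover have "{y\<in>V. h y = c} \<subseteq> F (Suc n) y" if "y \<in> V" "h y = c" for y
      using fib[OF c] ph[OF that(1)] that(2) by auto
    ultimately show ?thesis
      unfolding block_def fibim[OF c] using G_card[OF pc c refl] VL by auto
  qed
  have "{y\<in>V. h y = E n x} = W"
  proof -
    have im: "F n ` {y\<in>V. h y = E n x} = F n ` W"
      using fibim[OF \<open>E n x \<in> ?T\<close>] G_base p(2) by simp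
    have saturated: "A \<subseteq> A'" if im: "F n ` A \<subseteq> F n ` A'" and A: "block n A" "block n A'" for A A'
    proof
      fix y assume y: "y \<in> A"
      then obtain y' where y': "y' \<in> A'" "F n y = F n y'" using im by blast
      have "y \<in> F n y'" using y y'(2) Y.centre_mem A(1) unfolding block_def by blast
      then show "y \<in> A'" using y'(1) A(2) unfolding block_def by blast
    qed
    show ?thesis
      using saturated[OF _ blk[OF \<open>E n x \<in> ?T\<close>] W(1)] saturated[OF _ W(1) blk[OF \<open>E n x \<in> ?T\<close>]] im
      by blast
  qed
  then show thesis using that[of h] hT hF blk by blast
qed

text \<open>Gluing interleavings of the parts given by \<open>block_map\<close>. For points in different parts nothing has to
  be checked below level \<open>n + 1\<close>, because they lie in different level-\<open>n\<close> balls of \<open>L\<close> and are sent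
  to different level-\<open>n\<close> balls of \<open>M\<close>; from level \<open>n + 1\<close> on, both conditions hold since \<open>V\<close> lies in
  one level-\<open>(n + 2)\<close> ball and its image in one level-\<open>(n + 1)\<close> ball. The assumption \<open>fill\<close> is the
  induction hypothesis of \<open>interleaving_block\<close>, of which this lemma is the induction step.\<close>

lemma interleaving_extend:
  assumes x: "x \<in> M" and V: "block (Suc n) V" and W: "block n W" "W \<subseteq> V" "card (F n ` W) = a n"
    and g0: "interleaving W (E n x) g0"
    and fill: "\<And>V x. x \<in> M \<Longrightarrow> block n V \<Longrightarrow> \<exists>g. interleaving V (E n x) g"
  shows "\<exists>g. interleaving V (E (Suc n) x) g \<and> (\<forall>y\<in>W. g y = g0 y)"
proof -
  let ?U = "E (Suc n) x"
  have VL: "V \<subseteq> L" and Vsub: "\<And>y. y \<in> V \<Longrightarrow> V \<subseteq> F (Suc (Suc n)) y"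
    using V unfolding block_def by auto
  have UM: "?U \<subseteq> M" using X.ball_subset x by blast
  obtain h where h: "h \<in> V \<rightarrow> E n ` ?U"
    "\<And>y y'. y \<in> V \<Longrightarrow> y' \<in> F n y \<Longrightarrow> h y' = h y"
    "\<And>c. c \<in> E n ` ?U \<Longrightarrow> block n {y\<in>V. h y = c}"
    "{y\<in>V. h y = E n x} = W"
    by (rule block_map[OF x V W]) (rule that)
  have "\<exists>g. interleaving {y\<in>V. h y = c} c g \<and> (c = E n x \<longrightarrow> g = g0)" if c: "c \<in> E n ` ?U" for c
  proof (cases "c = E n x")
    case True
    then show ?thesis using h(4) g0 by auto
  next
    case False
    moreover obtain z where "z \<in> M" "c = E n z" using c UM by blast
    ultimately show ?thesis using fill[OF _ h(3)[OF c]] by blast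
  qed
  then obtain G where G: "\<And>c. c \<in> E n ` ?U \<Longrightarrow> interleaving {y\<in>V. h y = c} c (G c)"
    and G0: "\<And>c. c \<in> E n ` ?U \<Longrightarrow> c = E n x \<Longrightarrow> G c = g0"
    by metis
  define g where "g = (\<lambda>y. G (h y) y)"
  have gh: "g y \<in> h y" if "y \<in> V" for y
    using G[of "h y"] h(1) that unfolding interleaving_def g_def by blast
  have ball: "c = E n z" if "c \<in> E n ` ?U" "z \<in> c" for c z
    using that UM X.ball_eq by blast
  have hsub: "c \<subseteq> ?U" if "c \<in> E n ` ?U" for c
  proof -
    obtain z where z: "z \<in> ?U" "c = E n z" using \<open>c \<in> E n ` ?U\<close> by blast
    then show ?thesis using X.ball_Suc[of z n] X.ball_eq[OF x z(1)] UM by blast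
  qed
  have gU: "g y \<in> ?U" if "y \<in> V" for y using gh that hsub h(1) by blast
  have hE: "h y = E n (g y)" if "y \<in> V" for y using ball gh that h(1) by blast
  have same: "interleaving {z\<in>V. h z = h y} (h y) (G (h y))" if "y \<in> V" for y
    using G h(1) that by blast
  have fwd: "g y' \<in> E m (g y)" if y: "y \<in> V" "y' \<in> V" and m: "y' \<in> F m y" for m y y'
  proof (cases "h y' = h y")
    case True
    then show ?thesis
      using same[OF y(1)] y m unfolding interleaving_def g_def by auto
  next
    case False
    then have "\<not> m \<le> n" using h(2)[OF y(1), of y'] Y.ball_mono[of y m n] y VL m by blast
    then have "E (Suc n) (g y) \<subseteq> E m (g y)" using X.ball_mono[of "g y" "Suc n" m] gU[OF y(1)] UM by auto
    moreover have "g y' \<in> E (Suc n) (g y)" using X.ball_eq[OF x gU[OF y(1)]] gU[OF y(2)] by simp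
    ultimately show ?thesis by blast
  qed
  have bwd: "y' \<in> F (Suc m) y" if y: "y \<in> V" "y' \<in> V" and m: "g y' \<in> E m (g y)" for m y y'
  proof (cases "h y' = h y")
    case True
    then show ?thesis
      using same[OF y(1)] y m unfolding interleaving_def g_def by auto
  next
    case False
    then have "\<not> m \<le> n"
      using X.ball_eq_mono[of "g y" "g y'" m n] m gU[OF y(1)] UM hE[OF y(1)] hE[OF y(2)] by blast
    then have "F (Suc (Suc n)) y \<subseteq> F (Suc m) y" using Y.ball_mono[of y "Suc (Suc n)" "Suc m"] y(1) VL by auto
    then show ?thesis using Vsub[OF y(1)] y(2) by blast
  qed
  have onto: "\<exists>y\<in>V. g y \<in> E 0 z" if "z \<in> ?U" for z
  proof -
    have "E n z \<in> E n ` ?U" "z \<in> E n z" using that X.centre_mem UM by blast+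
    then obtain y where "y \<in> V" "h y = E n z" "G (E n z) y \<in> E 0 z"
      using G[of "E n z"] unfolding interleaving_def by blast
    then show ?thesis unfolding g_def by (intro bexI[of _ y]) auto
  qed
  have "interleaving V ?U g"
    unfolding interleaving_def using gU fwd bwd onto by blast
  moreover have "g y = g0 y" if "y \<in> W" for y
  proof -
    have "y \<in> V" "h y = E n x" using that h(4) by auto
    then show ?thesis using G0[of "E n x"] funcset_mem[OF h(1), of y] unfolding g_def by auto
  qed
  ultimately show ?thesis by blast
qed

lemma interleaving_0: "x \<in> M \<Longrightarrow> block 0 V \<Longrightarrow> \<exists>g. interleaving V (E 0 x) g"
proof -
  assume x: "x \<in> M" and V: "block 0 V"
  have "y' \<in> F (Suc m) y" if "y \<in> V" "y' \<in> V" for y y' m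
    using V that Y.ball_mono[of y "Suc 0" "Suc m"] unfolding block_def by blast
  moreover have "\<exists>y. y \<in> V" using block_nonempty[OF V] by blast
  ultimately have "interleaving V (E 0 x) (\<lambda>_. x)"
    using x X.centre_mem X.ball_sym unfolding interleaving_def by auto
  then show ?thesis by blast
qed

lemma interleaving_block: "x \<in> M \<Longrightarrow> block n V \<Longrightarrow> \<exists>g. interleaving V (E n x) g"
proof (induction n arbitrary: V x)
  case 0
  then show ?case by (rule interleaving_0)
next
  case (Suc n)
  obtain y0 where y0: "y0 \<in> V" using block_nonempty[OF Suc.prems(2)] by blast
  then have "y0 \<in> L" "F (Suc n) y0 \<subseteq> V" using Suc.prems(2) unfolding block_def by auto
  then obtain W where W: "block n W" "W \<subseteq> V" "card (F n ` W) = a n"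
    using block_of_subballs[of y0 n] by blast
  obtain g0 where "interleaving W (E n x) g0" using Suc.IH[OF Suc.prems(1) W(1)] by blast
  then show ?case
    using interleaving_extend[OF Suc.prems W _ Suc.IH] by blast
qed

text \<open>The minimal blocks \<open>W n\<close> around \<open>y0\<close> increase because \<open>W n\<close> lies in the ball of level \<open>n + 1\<close> around
  \<open>y0\<close>, and this ball lies in \<open>W (n + 1)\<close>. Interleavings of \<open>W n\<close> with \<open>E n x0\<close> are chosen
  successively as extensions of each other. Every condition on their union concerns at most two
  points of \<open>L\<close>, which lie in a common \<open>W n\<close>.\<close>

theorem ex_interleaving:
  assumes x0: "x0 \<in> M" and y0: "y0 \<in> L"
  shows "\<exists>g. interleaving L M g"
proof -
  obtain W where W: "\<And>n. block n (W n)" "\<And>n. F n y0 \<subseteq> W n" "\<And>n. W n \<subseteq> F (Suc n) y0"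
      "\<And>n. card (F n ` W n) = a n"
    using block_of_subballs[OF y0] by metis
  have W_Suc: "W n \<subseteq> W (Suc n)" for n using W(2,3) by blast
  have W_mono: "W m \<subseteq> W n" if "m \<le> n" for m n
    using that by (rule lift_Suc_mono_le[of W, rotated]) (rule W_Suc)
  obtain G where G: "\<And>n. interleaving (W n) (E n x0) (G n)"
      and G_Suc: "\<And>n y. y \<in> W n \<Longrightarrow> G (Suc n) y = G n y"
  proof -
    have "\<exists>G. \<forall>n. interleaving (W n) (E n x0) (G n) \<and> (\<forall>y\<in>W n. G (Suc n) y = G n y)"
    proof (rule dependent_nat_choice)
      show "\<exists>g. interleaving (W 0) (E 0 x0) g" by (rule interleaving_0[OF x0 W(1)])
      show "\<exists>g'. interleaving (W (Suc n)) (E (Suc n) x0) g' \<and> (\<forall>y\<in>W n. g' y = g y)"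
        if "interleaving (W n) (E n x0) g" for g n
        using interleaving_extend[OF x0 W(1) W(1) W_Suc W(4) that interleaving_block] by blast
    qed
    then show thesis using that by blast
  qed
  have G_mono: "G n y = G m y" if "y \<in> W m" "m \<le> n" for m n y
    using that(2)
  proof (induction rule: dec_induct)
    case (step n)
    then show ?case using G_Suc[of y n] W_mono[of m n] that(1) by auto
  qed simp
  have ex: "\<exists>n. y \<in> W n" if "y \<in> L" for y using W(2) Y.exhausts[OF y0 that] by blast
  define g where "g = (\<lambda>y. G (LEAST n. y \<in> W n) y)"
  have g: "g y = G n y" if "y \<in> W n" for y n
    unfolding g_def using G_mono[of y "LEAST n. y \<in> W n" n] that by (metis LeastI Least_le)
  have common: "\<exists>n. y \<in> W n \<and> y' \<in> W n" if "y \<in> L" "y' \<in> L" for y y'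
    using ex[OF that(1)] ex[OF that(2)] W_mono by (metis linear subsetD)
  have "g y \<in> M" if y: "y \<in> L" for y
  proof -
    obtain n where "y \<in> W n" using ex[OF y] by blast
    then show ?thesis using g G[of n] X.ball_subset[OF x0, of n] unfolding interleaving_def by auto
  qed
  moreover have "g y' \<in> E m (g y)" if y: "y \<in> L" "y' \<in> L" "y' \<in> F m y" for m y y'
  proof -
    obtain n where "y \<in> W n" "y' \<in> W n" using common y by blast
    then show ?thesis using g G[of n] y(3) unfolding interleaving_def by auto
  qed
  moreover have "y' \<in> F (Suc m) y" if y: "y \<in> L" "y' \<in> L" "g y' \<in> E m (g y)" for m y y'
  proof -
    obtain n where "y \<in> W n" "y' \<in> W n" using common y by blast
    then show ?thesis using g G[of n] y(3) unfolding interleaving_def by auto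
  qed
  moreover have "\<exists>y\<in>L. g y \<in> E 0 x" if x: "x \<in> M" for x
  proof -
    obtain n where "x \<in> E n x0" using X.exhausts[OF x0 x] by blast
    then obtain y where "y \<in> W n" "G n y \<in> E 0 x"
      using G[of n] unfolding interleaving_def by blast
    then show ?thesis using g W(1)[of n] unfolding block_def by (intro bexI[of _ y]) auto
  qed
  ultimately show ?thesis unfolding interleaving_def by blast
qed

end

section \<open>Balls in homogeneous proper ultrametric spaces\<close>

context Ultrametric_space
begin

lemma mcball_eq:
  assumes "y \<in> mcball x r"
  shows "mcball y r = mcball x r"
proof -
  have M: "x \<in> M" "y \<in> M" "d x y \<le> r" "d y x \<le> r" using assms commute by auto
  have "d y z \<le> r \<longleftrightarrow> d x z \<le> r" if "z \<in> M" for z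
    using ultrametric[OF M(1) that M(2)] ultrametric[OF M(2) that M(1)] M by linarith
  then show ?thesis using M by auto
qed

lemma proper_nonempty: "proper \<Longrightarrow> M \<noteq> {}"
  unfolding proper_def by (metis mbounded_empty)

lemma radii_unbounded:
  assumes "proper" "\<And>x y. x \<in> M \<Longrightarrow> y \<in> M \<Longrightarrow> \<exists>n. y \<in> mcball x (r n)"
  shows "\<exists>n. \<epsilon> \<le> r n"
proof (rule ccontr)
  assume *: "\<nexists>n. \<epsilon> \<le> r n"
  have "d x y \<le> \<epsilon>" if xy: "x \<in> M" "y \<in> M" for x y
  proof -
    obtain n where "y \<in> mcball x (r n)" using assms(2)[OF xy] by blast
    then show ?thesis using * by (meson in_mcball le_cases order_trans)
  qed
  then have "mbounded M" unfolding mbounded_alt by blast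
  then show False using assms(1) unfolding proper_def by blast
qed

text \<open>Finitely many open balls of radius \<open>r\<close> cover the compact ball, and the closed ball of radius \<open>r\<close>
  around a point depends only on the member of the cover that contains the point.\<close>

lemma finite_mcballs_in_mcball:
  assumes "proper" "0 < r"
  shows "finite ((\<lambda>y. mcball y r) ` mcball x R)"
proof (cases "x \<in> M \<and> 0 \<le> R")
  case True
  then have "compactin mtopology (mcball x R)" using assms(1) unfolding proper_def by blast
  moreover have "\<forall>U\<in>(\<lambda>y. mball y r) ` mcball x R. openin mtopology U" by auto
  moreover have "mcball x R \<subseteq> \<Union>((\<lambda>y. mball y r) ` mcball x R)" using assms(2) by auto
  ultimately obtain \<F> where \<F>: "finite \<F>" "\<F> \<subseteq> (\<lambda>y. mball y r) ` mcball x R" "mcball x R \<subseteq> \<Union>\<F>"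
    unfolding compactin_def by meson
  then obtain Z where Z: "finite Z" "\<F> = (\<lambda>y. mball y r) ` Z"
    using finite_subset_image by metis
  have "(\<lambda>y. mcball y r) ` mcball x R \<subseteq> (\<lambda>y. mcball y r) ` Z"
  proof
    fix C assume "C \<in> (\<lambda>y. mcball y r) ` mcball x R"
    then obtain y where y: "C = mcball y r" "y \<in> mcball x R" by blast
    then obtain z where z: "z \<in> Z" "y \<in> mball z r" using \<F>(3) Z(2) by blast
    then have "C = mcball z r" using y(1) mcball_eq mball_subset_mcball by blast
    then show "C \<in> (\<lambda>y. mcball y r) ` Z" using z(1) by blast
  qed
  then show ?thesis using Z(1) finite_subset by blast
next
  case False
  then have "mcball x R = {}" using mcball_eq_empty by auto
  then show ?thesis by simp
qed

lemma card_mcballs_homogeneous: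
  assumes "homogeneous" "x \<in> M" "x' \<in> M"
  shows "card ((\<lambda>y. mcball y r) ` mcball x' R) = card ((\<lambda>y. mcball y r) ` mcball x R)"
proof -
  obtain f where f: "bij_betw f M M" "\<And>u v. u \<in> M \<Longrightarrow> v \<in> M \<Longrightarrow> d (f u) (f v) = d u v" "f x = x'"
    using assms unfolding homogeneous_def by blast
  have fM: "f z \<in> M" if "z \<in> M" for z using f(1) that by (rule bij_betwE[rule_format])
  have f_mcball: "f ` mcball y s = mcball (f y) s" if y: "y \<in> M" for y s
  proof
    show "f ` mcball y s \<subseteq> mcball (f y) s" using f(2) fM y by auto
    show "mcball (f y) s \<subseteq> f ` mcball y s"
    proof
      fix z assume z: "z \<in> mcball (f y) s"
      then obtain w where "w \<in> M" "z = f w" using f(1) unfolding bij_betw_def by auto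
      then show "z \<in> f ` mcball y s" using z f(2)[OF y] y by auto
    qed
  qed
  have "(\<lambda>y. mcball y r) ` mcball x' R = (\<lambda>y. mcball (f y) r) ` mcball x R"
    unfolding f(3)[symmetric] f_mcball[OF assms(2), symmetric] by (rule image_image)
  also have "\<dots> = (\<lambda>C. f ` C) ` (\<lambda>y. mcball y r) ` mcball x R"
    unfolding image_image using f_mcball by (intro image_cong) auto
  also have "card \<dots> = card ((\<lambda>y. mcball y r) ` mcball x R)"
  proof (rule card_image)
    have "inj_on ((`) f) (Pow M)" using f(1) inj_on_image_Pow unfolding bij_betw_def by blast
    then show "inj_on ((`) f) ((\<lambda>y. mcball y r) ` mcball x R)"
      by (rule inj_on_subset) auto
  qed
  finally show ?thesis .
qed

text \<open>An unbounded space has infinitely many balls of radius \<open>r\<close>; any \<open>N\<close> of them have centres in a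
  common ball of some radius \<open>R\<close>. Homogeneity carries the count from one centre to all.\<close>

lemma ex_uniform_subdivision:
  assumes "homogeneous" "proper" "0 < r"
  shows "\<exists>R k. r + 1 \<le> R \<and> N \<le> k \<and> 0 < k \<and> (\<forall>x\<in>M. card ((\<lambda>y. mcball y r) ` mcball x R) = k)"
proof -
  have unb: "\<not> mbounded M" using assms(2) unfolding proper_def by blast
  obtain x0 where x0: "x0 \<in> M" using proper_nonempty[OF assms(2)] by blast
  have "infinite ((\<lambda>y. mcball y r) ` M)"
  proof
    assume "finite ((\<lambda>y. mcball y r) ` M)"
    then have "mbounded (\<Union>((\<lambda>y. mcball y r) ` M))"
      by (rule mbounded_Union) (auto simp: mbounded_mcball)
    moreover have "M \<subseteq> \<Union>((\<lambda>y. mcball y r) ` M)" using assms(3) by auto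
    ultimately show False using unb mbounded_subset by blast
  qed
  then obtain \<C> where \<C>: "\<C> \<subseteq> (\<lambda>y. mcball y r) ` M" "card \<C> = N" "finite \<C>"
    using infinite_arbitrarily_large by metis
  then obtain S where S: "finite S" "S \<subseteq> M" "\<C> = (\<lambda>y. mcball y r) ` S"
    using finite_subset_image by metis
  define R where "R = Max (insert (r + 1) (d x0 ` S))"
  have R: "r + 1 \<le> R" "\<And>y. y \<in> S \<Longrightarrow> d x0 y \<le> R"
    unfolding R_def using S(1) by auto
  then have "S \<subseteq> mcball x0 R" using S(2) x0 by auto
  then have sub: "\<C> \<subseteq> (\<lambda>y. mcball y r) ` mcball x0 R" unfolding S(3) by (rule image_mono)
  let ?k = "card ((\<lambda>y. mcball y r) ` mcball x0 R)"
  have fin: "finite ((\<lambda>y. mcball y r) ` mcball x0 R)"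
    by (rule finite_mcballs_in_mcball[OF assms(2,3)])
  have "N \<le> ?k" using card_mono[OF fin sub] \<C>(2) by simp
  moreover have "x0 \<in> mcball x0 R" using x0 R(1) assms(3) by simp
  then have "0 < ?k" using fin by (metis card_gt_0_iff empty_iff image_is_empty)
  moreover have "\<forall>x\<in>M. card ((\<lambda>y. mcball y r) ` mcball x R) = ?k"
    using card_mcballs_homogeneous[OF assms(1) x0] by blast
  ultimately show ?thesis using R(1) by blast
qed

text \<open>Consecutive radii differ by at least 1, so they tend to infinity and the balls exhaust the space.\<close>

lemma ball_tower_mcball:
  fixes r :: "nat \<Rightarrow> real"
  assumes "0 < r 0" "\<And>n. r n + 1 \<le> r (Suc n)" "\<And>n. 0 < k n"
    and "\<And>n x. x \<in> M \<Longrightarrow> card ((\<lambda>y. mcball y (r n)) ` mcball x (r (Suc n))) = k n"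
  shows "ball_tower M (\<lambda>n x. mcball x (r n)) k"
proof
  have r: "real n < r n" for n
  proof (induction n)
    case (Suc n)
    then show ?case using assms(2)[of n] by simp
  qed (use assms(1) in simp)
  show "x \<in> mcball x (r n)" if "x \<in> M" for x n
    using that r[of n] by auto
  show "mcball x (r n) \<subseteq> M" for x n by auto
  show "mcball y (r n) = mcball x (r n)" if "y \<in> mcball x (r n)" for x y n
    using mcball_eq[OF that] .
  show "mcball x (r n) \<subseteq> mcball x (r (Suc n))" for x n
    using assms(2)[of n] by auto
  show "\<exists>n. y \<in> mcball x (r n)" if "x \<in> M" "y \<in> M" for x y
  proof -
    obtain n where "d x y < real n" using reals_Archimedean2 by blast
    then show ?thesis using r[of n] that by (intro exI[of _ n]) auto
  qed
  show "card ((\<lambda>y. mcball y (r n)) ` mcball x (r (Suc n))) = k n" if "x \<in> M" for x n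
    using assms(4)[OF that] .
  show "0 < k n" for n by (rule assms(3))
qed

end

section \<open>The choice of radii\<close>

text \<open>The interval from \<open>q / b + 1\<close> to \<open>q / a\<close> has length at least 2 when \<open>q \<ge> 3 * a * b\<close>,
  which leaves room for two consecutive integers.\<close>

lemma multiplicity_range:
  fixes a b q :: nat
  assumes "0 < a" "a < b" "3 * a * b \<le> q"
  obtains u v where "0 < u" "u < v" "v * a \<le> q" "q \<le> (u - 1) * b"
proof -
  define m where "m = q div b"
  have "3 * a * b div b \<le> m" unfolding m_def by (rule div_le_mono[OF assms(3)])
  then have 1: "3 * a \<le> m" using assms(2) by simp
  have 2: "m * b \<le> q" "q \<le> (m + 1) * b"
    unfolding m_def using assms(2) dividend_less_div_times[of b q] by auto
  have "m * (a + 1) \<le> m * b" using assms(2) by (intro mult_le_mono2) simp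
  then have "(m + 3) * a \<le> q" using 1 2 by (simp add: algebra_simps)
  then show thesis using that[of "m + 2" "m + 3"] 2 by simp
qed

text \<open>Likewise two consecutive integers fit between \<open>k / v\<close> and \<open>k / u\<close>.\<close>

lemma size_range:
  fixes u v k :: nat
  assumes "0 < u" "u < v" "2 * u * v \<le> k"
  obtains a b where "0 < a" "a < b" "b * u \<le> k" "k \<le> a * v"
proof -
  define m where "m = k div v"
  have "2 * u * v div v \<le> m" unfolding m_def by (rule div_le_mono[OF assms(3)])
  then have 1: "2 * u \<le> m" using assms(2) by simp
  have 2: "m * v \<le> k" "k \<le> (m + 1) * v"
    unfolding m_def using assms(2) dividend_less_div_times[of v k] by auto
  have "m * (u + 1) \<le> m * v" using assms(2) by (intro mult_le_mono2) simp
  then have "(m + 2) * u \<le> k" using 1 2 by (simp add: algebra_simps)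
  then show thesis using that[of "m + 1" "m + 2"] 2 by simp
qed

text \<open>The radii and the bounds are found by recursion on states \<open>(r, s, a, b)\<close>. The order of choices in
  one step matters: the ball of \<open>Y\<close> is enlarged first, to make room for \<open>u < v\<close>; only then the ball
  of \<open>X\<close>, by an amount depending on \<open>u\<close> and \<open>v\<close>, to make room for the next \<open>a < b\<close>.\<close>

lemma ex_interleaved_radii:
  assumes X: "Ultrametric_space X d" "Metric_space.homogeneous X d" "Metric_space.proper X d"
    and Y: "Ultrametric_space Y e" "Metric_space.homogeneous Y e" "Metric_space.proper Y e"
  obtains r s :: "nat \<Rightarrow> real" and k q a b u v
  where "interleaved_towers X (\<lambda>n x. Metric_space.mcball X d x (r n)) k
           Y (\<lambda>n y. Metric_space.mcball Y e y (s n)) q a b u v"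
proof -
  interpret X: Ultrametric_space X d by (rule X(1))
  interpret Y: Ultrametric_space Y e by (rule Y(1))
  define step :: "real \<times> real \<times> nat \<times> nat \<Rightarrow> real \<times> real \<times> nat \<times> nat \<Rightarrow> nat \<times> nat \<times> nat \<times> nat \<Rightarrow> bool"
    where "step = (\<lambda>(r, s, a, b) (r', s', a', b') (k, q, u, v).
      r + 1 \<le> r' \<and> s + 1 \<le> s' \<and> 0 < k \<and> 0 < q \<and>
      (\<forall>x\<in>X. card ((\<lambda>y. X.mcball y r) ` X.mcball x r') = k) \<and>
      (\<forall>x\<in>Y. card ((\<lambda>y. Y.mcball y s) ` Y.mcball x s') = q) \<and>
      v * a \<le> q \<and> q \<le> (u - 1) * b \<and> b' * u \<le> k \<and> k \<le> a' * v)"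
  define good :: "real \<times> real \<times> nat \<times> nat \<Rightarrow> bool"
    where "good = (\<lambda>(r, s, a, b). 0 < r \<and> 0 < s \<and> 0 < a \<and> a < b)"
  have next_state: "\<exists>st'. good st' \<and> (\<exists>p. step st st' p)" if "good st" for st
  proof -
    obtain r s a b where st: "st = (r, s, a, b)" by (cases st) auto
    have pos: "0 < r" "0 < s" "0 < a" "a < b" using that unfolding good_def st by auto
    obtain s' q where q: "s + 1 \<le> s'" "3 * a * b \<le> q" "0 < q"
        "\<forall>x\<in>Y. card ((\<lambda>y. Y.mcball y s) ` Y.mcball x s') = q"
      using Y.ex_uniform_subdivision[OF Y(2,3) pos(2), of "3 * a * b"] by blast
    obtain u v where uv: "0 < u" "u < v" "v * a \<le> q" "q \<le> (u - 1) * b"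
      using multiplicity_range[OF pos(3,4) q(2)] by blast
    obtain r' k where k: "r + 1 \<le> r'" "2 * u * v \<le> k" "0 < k"
        "\<forall>x\<in>X. card ((\<lambda>y. X.mcball y r) ` X.mcball x r') = k"
      using X.ex_uniform_subdivision[OF X(2,3) pos(1), of "2 * u * v"] by blast
    obtain a' b' where ab: "0 < a'" "a' < b'" "b' * u \<le> k" "k \<le> a' * v"
      using size_range[OF uv(1,2) k(2)] by blast
    have "step st (r', s', a', b') (k, q, u, v)"
      unfolding step_def st using q k uv ab by simp
    moreover have "good (r', s', a', b')"
      unfolding good_def using pos q(1) k(1) ab by simp
    ultimately show ?thesis by blast
  qed
  have "\<exists>st. \<forall>n. good (st n) \<and> (\<exists>p. step (st n) (st (Suc n)) p)"
  proof (rule dependent_nat_choice)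
    show "\<exists>st. good st"
      unfolding good_def by (intro exI[of _ "(1, 1, 1, 2)"]) simp
    show "\<exists>st'. good st' \<and> (\<exists>p. step st st' p)" if "good st" for st n
      using next_state[OF that] .
  qed
  then obtain st p where good: "\<And>n. good (st n)" and step: "\<And>n. step (st n) (st (Suc n)) (p n)"
    by metis
  define r where "r = (\<lambda>n. fst (st n))"
  define s where "s = (\<lambda>n. fst (snd (st n)))"
  define a where "a = (\<lambda>n. fst (snd (snd (st n))))"
  define b where "b = (\<lambda>n. snd (snd (snd (st n))))"
  define k where "k = (\<lambda>n. fst (p n))"
  define q where "q = (\<lambda>n. fst (snd (p n)))"
  define u where "u = (\<lambda>n. fst (snd (snd (p n))))"
  define v where "v = (\<lambda>n. snd (snd (snd (p n))))"
  note defs = r_def s_def a_def b_def k_def q_def u_def v_def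
  have good': "0 < r n \<and> 0 < s n \<and> 0 < a n \<and> a n < b n" for n
    using good[of n] unfolding good_def defs by (simp add: case_prod_unfold)
  have step': "r n + 1 \<le> r (Suc n) \<and> s n + 1 \<le> s (Suc n) \<and> 0 < k n \<and> 0 < q n \<and>
      (\<forall>x\<in>X. card ((\<lambda>y. X.mcball y (r n)) ` X.mcball x (r (Suc n))) = k n) \<and>
      (\<forall>x\<in>Y. card ((\<lambda>y. Y.mcball y (s n)) ` Y.mcball x (s (Suc n))) = q n) \<and>
      v n * a n \<le> q n \<and> q n \<le> (u n - 1) * b n \<and> b (Suc n) * u n \<le> k n \<and> k n \<le> a (Suc n) * v n" for n
    using step[of n] unfolding step_def defs case_prod_unfold by blast
  have "ball_tower X (\<lambda>n x. X.mcball x (r n)) k"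
    by (rule X.ball_tower_mcball) (use good' step' in blast)+
  moreover have "ball_tower Y (\<lambda>n y. Y.mcball y (s n)) q"
    by (rule Y.ball_tower_mcball) (use good' step' in blast)+
  moreover have "interleaved_towers_axioms k q a b u v"
    by unfold_locales (use good' step' less_imp_le in blast)+
  ultimately show thesis
    using that unfolding interleaved_towers_def by blast
qed

section \<open>The coarse equivalence\<close>

text \<open>The inverse \<open>f\<close> of an interleaving \<open>g\<close> picks any point that \<open>g\<close> sends to within \<open>r 0\<close> of the given
  one.\<close>

theorem coarsely_equivalent_homogeneous_proper:
  assumes X: "Ultrametric_space X d" "Metric_space.homogeneous X d" "Metric_space.proper X d"
    and Y: "Ultrametric_space Y e" "Metric_space.homogeneous Y e" "Metric_space.proper Y e"
  shows "coarsely_equivalent X d Y e"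
proof -
  interpret X: Ultrametric_space X d by (rule X(1))
  interpret Y: Ultrametric_space Y e by (rule Y(1))
  obtain r s k q a b u v where "interleaved_towers X (\<lambda>n x. X.mcball x (r n)) k
           Y (\<lambda>n y. Y.mcball y (s n)) q a b u v"
    by (rule ex_interleaved_radii[OF X Y])
  then interpret T: interleaved_towers X "\<lambda>n x. X.mcball x (r n)" k
           Y "\<lambda>n y. Y.mcball y (s n)" q a b u v .
  have "X \<noteq> {}" "Y \<noteq> {}"
    using X.proper_nonempty[OF X(3)] Y.proper_nonempty[OF Y(3)] by auto
  then obtain g where g: "T.interleaving Y X g"
    using T.ex_interleaving by blast
  have gX: "g y \<in> X" if "y \<in> Y" for y using g that unfolding T.interleaving_def by blast
  have fwd: "d (g y) (g y') \<le> r m" if "y \<in> Y" "y' \<in> Y" "e y y' \<le> s m" for m y y'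
    using g that unfolding T.interleaving_def by auto
  have bwd: "e y y' \<le> s (Suc m)" if "y \<in> Y" "y' \<in> Y" "d (g y) (g y') \<le> r m" for m y y'
    using g that gX unfolding T.interleaving_def by auto
  have "\<exists>y\<in>Y. d (g y) x \<le> r 0" if x: "x \<in> X" for x
  proof -
    obtain y where "y \<in> Y" "g y \<in> X.mcball x (r 0)"
      using g x unfolding T.interleaving_def by blast
    then show ?thesis using X.commute by auto
  qed
  then obtain f where fY: "\<And>x. x \<in> X \<Longrightarrow> f x \<in> Y" and gf: "\<And>x. x \<in> X \<Longrightarrow> d (g (f x)) x \<le> r 0"
    by metis
  have r_ge: "\<exists>n. \<epsilon> \<le> r n" for \<epsilon>
    using X.radii_unbounded[OF X(3) T.X.exhausts] .
  have s_ge: "\<exists>n. \<epsilon> \<le> s n" for \<epsilon>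
    using Y.radii_unbounded[OF Y(3) T.Y.exhausts] .
  have "bornologous X d e f"
    unfolding bornologous_def
  proof
    fix \<epsilon>
    \<comment> \<open>Replacing \<open>x\<close> by \<open>g (f x)\<close> moves it by at most \<open>r 0\<close>, which the radius \<open>r n\<close> absorbs.\<close>
    obtain n where n: "max \<epsilon> (r 0) \<le> r n" using r_ge by blast
    have "e (f x) (f x') \<le> s (Suc n)" if x: "x \<in> X" "x' \<in> X" "d x x' \<le> \<epsilon>" for x x'
    proof (rule bwd)
      have g: "g (f x) \<in> X" "g (f x') \<in> X" using gX fY x by auto
      have "d (g (f x)) (g (f x')) \<le> max (d (g (f x)) x) (d x (g (f x')))"
        using X.ultrametric g x by blast
      also have "d x (g (f x')) \<le> max (d x x') (d x' (g (f x')))"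
        using X.ultrametric g x by blast
      finally show "d (g (f x)) (g (f x')) \<le> r n"
        using gf[OF x(1)] gf[OF x(2)] x(3) n X.commute[of x' "g (f x')"] by linarith
    qed (use fY x in auto)
    then show "\<exists>\<delta>. \<forall>x\<in>X. \<forall>x'\<in>X. d x x' \<le> \<epsilon> \<longrightarrow> e (f x) (f x') \<le> \<delta>" by blast
  qed
  moreover have "bornologous Y e d g"
    unfolding bornologous_def
  proof
    fix \<epsilon>
    obtain n where "\<epsilon> \<le> s n" using s_ge by blast
    then have "\<forall>x\<in>Y. \<forall>x'\<in>Y. e x x' \<le> \<epsilon> \<longrightarrow> d (g x) (g x') \<le> r n"
      using fwd order_trans by blast
    then show "\<exists>\<delta>. \<forall>x\<in>Y. \<forall>x'\<in>Y. e x x' \<le> \<epsilon> \<longrightarrow> d (g x) (g x') \<le> \<delta>" by blast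
  qed
  moreover have "map_dist X d (g \<circ> f) id < \<infinity>"
  proof -
    have "map_dist X d (g \<circ> f) id \<le> ennreal (r 0)"
      unfolding map_dist_def by (intro SUP_least ennreal_leI) (simp add: gf)
    then show ?thesis by (simp add: le_less_trans)
  qed
  moreover have "map_dist Y e (f \<circ> g) id < \<infinity>"
  proof -
    have "e (f (g y)) y \<le> s (Suc 0)" if y: "y \<in> Y" for y
      using bwd[OF fY[OF gX[OF y]] y gf[OF gX[OF y]]] .
    then have "map_dist Y e (f \<circ> g) id \<le> ennreal (s (Suc 0))"
      unfolding map_dist_def by (intro SUP_least ennreal_leI) simp
    then show ?thesis by (simp add: le_less_trans)
  qed
  moreover have "f \<in> X \<rightarrow> Y" "g \<in> Y \<rightarrow> X" using fY gX by auto
  ultimately show ?thesis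
    unfolding coarsely_equivalent_def by blast
qed

section \<open>The anti-Cantor set\<close>

text \<open>Flipping the coordinates in which \<open>x\<close> and \<open>y\<close> differ, which are finitely many, is an isometric
  involution that exchanges \<open>x\<close> and \<open>y\<close>.\<close>

lemma homogeneous_anti_Cantor: "Metric_space.homogeneous anti_Cantor anti_Cantor_dist"
proof -
  interpret Ultrametric_space anti_Cantor anti_Cantor_dist by (rule Ultrametric_space_anti_Cantor)
  show ?thesis
    unfolding homogeneous_def
  proof (intro ballI)
    fix x y assume x: "x \<in> anti_Cantor" and y: "y \<in> anti_Cantor"
    define f where "f = (\<lambda>(z::nat \<Rightarrow> nat) i. if x i = y i then z i else 1 - z i)"
    have bits: "z i = 0 \<or> z i = 1" if "z \<in> anti_Cantor" for z i
      using that unfolding anti_Cantor_def by auto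
    have closed: "f z \<in> anti_Cantor" if z: "z \<in> anti_Cantor" for z
    proof -
      obtain m1 m2 m3 where "\<forall>i\<ge>m1. x i = 0" "\<forall>i\<ge>m2. y i = 0" "\<forall>i\<ge>m3. z i = 0"
        using x y z unfolding anti_Cantor_def by blast
      then have "\<forall>i\<ge>max m1 (max m2 m3). f z i = 0" unfolding f_def by simp
      moreover have "f z i \<in> {0, 1}" for i using bits[OF z, of i] unfolding f_def by auto
      ultimately show ?thesis unfolding anti_Cantor_def by blast
    qed
    have inv: "f (f z) = z" if "z \<in> anti_Cantor" for z
    proof
      show "f (f z) i = z i" for i using bits[OF that, of i] unfolding f_def by auto
    qed
    have "bij_betw f anti_Cantor anti_Cantor"
      by (rule bij_betw_byWitness[of _ f]) (use closed inv in auto)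
    moreover have "anti_Cantor_dist (f w) (f z) = anti_Cantor_dist w z"
      if "w \<in> anti_Cantor" "z \<in> anti_Cantor" for w z
    proof -
      have "\<bar>real (f w n) - real (f z n)\<bar> = \<bar>real (w n) - real (z n)\<bar>" for n
        using bits[OF that(1), of n] bits[OF that(2), of n] unfolding f_def by auto
      then show ?thesis using that closed unfolding anti_Cantor_dist_def by simp
    qed
    moreover have "f x = y"
    proof
      show "f x i = y i" for i using bits[OF x, of i] bits[OF y, of i] unfolding f_def by auto
    qed
    ultimately show "\<exists>f. bij_betw f anti_Cantor anti_Cantor \<and>
        (\<forall>u\<in>anti_Cantor. \<forall>v\<in>anti_Cantor. anti_Cantor_dist (f u) (f v) = anti_Cantor_dist u v) \<and> f x = y"
      by blast
  qed
qed

text \<open>Balls are finite: points at distance at most \<open>R < 2 ^ m\<close> agree from the \<open>m\<close>-th coordinate on.\<close>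

lemma proper_anti_Cantor: "Metric_space.proper anti_Cantor anti_Cantor_dist"
proof -
  interpret Ultrametric_space anti_Cantor anti_Cantor_dist by (rule Ultrametric_space_anti_Cantor)
  have dist_ge: "2 ^ n * \<bar>real (x n) - real (y n)\<bar> \<le> anti_Cantor_dist x y"
    if "x \<in> anti_Cantor" "y \<in> anti_Cantor" for x y n
    using anti_Cantor_dist_le_iff[OF that, of "anti_Cantor_dist x y"] by blast
  have "\<not> mbounded anti_Cantor"
  proof
    assume "mbounded anti_Cantor"
    then obtain B where B: "\<And>x y. x \<in> anti_Cantor \<Longrightarrow> y \<in> anti_Cantor \<Longrightarrow> anti_Cantor_dist x y \<le> B"
      unfolding mbounded_alt by blast
    obtain n where n: "B < 2 ^ n" using real_arch_pow[of 2 B] by auto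
    let ?e = "(\<lambda>_. 0)(n := 1) :: nat \<Rightarrow> nat"
    have e: "?e \<in> anti_Cantor" unfolding anti_Cantor_def by (auto intro!: exI[of _ "Suc n"])
    have z: "(\<lambda>_. 0) \<in> anti_Cantor" unfolding anti_Cantor_def by auto
    show False using dist_ge[OF e z, of n] B[OF e z] n by simp
  qed
  moreover have "compactin mtopology (mcball x R)" if x: "x \<in> anti_Cantor" for x R
  proof (rule finite_imp_compactin)
    show "mcball x R \<subseteq> topspace mtopology" by auto
    obtain m where m: "R < 2 ^ m" using real_arch_pow[of 2 R] by auto
    obtain m' where m': "\<forall>i\<ge>m'. x i = 0" using x unfolding anti_Cantor_def by blast
    have "mcball x R \<subseteq> {y. \<forall>i. (i \<in> {..<max m m'} \<longrightarrow> y i \<in> {0, 1}) \<and> (i \<notin> {..<max m m'} \<longrightarrow> y i = 0)}"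
    proof (intro subsetI CollectI allI conjI impI)
      fix y i assume "y \<in> mcball x R"
      then have y: "y \<in> anti_Cantor" "anti_Cantor_dist x y \<le> R" by auto
      then show "y i \<in> {0, 1}" unfolding anti_Cantor_def by auto
      assume i: "i \<notin> {..<max m m'}"
      then have "2 ^ i * \<bar>real (x i) - real (y i)\<bar> < 2 ^ m"
        using dist_ge[OF x y(1), of i] y(2) m by linarith
      moreover have "(2::real) ^ m \<le> 2 ^ i" using i by simp
      ultimately have "\<bar>real (x i) - real (y i)\<bar> < 1"
        by (smt (verit) mult_le_cancel_left1 zero_less_power)
      then show "y i = 0" using m' i by simp
    qed
    then show "finite (mcball x R)"
      by (rule finite_subset) (rule finite_set_of_finite_funs, auto)
  qed
  ultimately show ?thesis unfolding proper_def by blast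
qed

theorem theorem1:
  fixes X :: "'a set" and d :: "'a \<Rightarrow> 'a \<Rightarrow> real"
  assumes "Ultrametric_space X d"
    and "Metric_space.homogeneous X d"
    and "Metric_space.proper X d"
  shows "coarsely_equivalent X d anti_Cantor anti_Cantor_dist"
  using coarsely_equivalent_homogeneous_proper[OF assms Ultrametric_space_anti_Cantor
      homogeneous_anti_Cantor proper_anti_Cantor] .

end
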